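(* Let $C$ be a nonempty closed convex subset of a real Hilbert space $H$. Let $T:C\to C$ be a Lipschitz pseudo-contraction with Lipschitz constant $L\ge1$ and $F(T)\ne\emptyset$. Suppose $\{\alpha_n\}_{n\ge0}$ and $\{\beta_n\}_{n\ge0}$ are two real sequences in $(0,1)$ satisfying, for some constants $\alpha',\alpha$: ($C_1$) $0<\beta_n\le\alpha_n$ for all $n\ge0$; ($C_2$) $\liminf_{n\to\infty}\alpha_n\ge\alpha'>0$; ($C_3$) $\limsup_{n\to\infty}\alpha_n\le\alpha<\frac{1}{\sqrt{1+L^2}+1}$. Let $x_0\in C$ be arbitrary and let $\{x_n\}$ be generated, for $n\ge0$, by $$v_n=(1-\alpha_n)x_n+\alpha_nTx_n,\qquad y_n=(1-\beta_n)x_n+\beta_nTv_n,$$ $$C_n=\{z\in C:\|y_n-z\|^2\le\|x_n-z\|^2-\alpha_n\beta_n(1-2\alpha_n-L^2\alpha_n^2)\|x_n-Tx_n\|^2\},$$ $$Q_n=\{z\in C:\langle z-x_n,x_n-x_0\rangle\ge0\},$$ $$x_{n+1}=P_{C_n^*\cap Q_n}x_0,$$ where $C_n^*$ is a closed convex set with $F(T)\subset C_n^*\subset C_n$. Then $\{x_n\}$ converges strongly to the fixed point $P_{F(T)}x_0$.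
   Context: $F(T)=\{x\in C:Tx=x\}$. $T$ is a pseudo-contraction if $\|Tx-Ty\|^2\le\|x-y\|^2+\|(I-T)x-(I-T)y\|^2$ for all $x,y\in C$ ($I$ the identity). $T$ is Lipschitz with constant $L$ if $\|Tx-Ty\|\le L\|x-y\|$ for all $x,y\in C$. For a nonempty closed convex set $D\subset H$, $P_D$ is the metric projection (nearest-point map) onto $D$. *)

theory Defs
  imports "HOL-Analysis.Analysis"
begin

definition fix_set :: "'a set \<Rightarrow> ('a \<Rightarrow> 'a) \<Rightarrow> 'a set"
  where "fix_set C T = {x \<in> C. T x = x}"

definition pseudo_contraction_on :: "'a::real_inner set \<Rightarrow> ('a \<Rightarrow> 'a) \<Rightarrow> bool"
  where "pseudo_contraction_on C T \<longleftrightarrow>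
    (\<forall>x\<in>C. \<forall>y\<in>C. (norm (T x - T y))\<^sup>2 \<le> (norm (x - y))\<^sup>2 + (norm ((x - T x) - (y - T y)))\<^sup>2)"

(* The library's closest_point requires the class heine_borel, that is, essentially finite
   dimension. The value is meaningful when D is a nonempty closed convex subset of a
   Hilbert space, where the nearest point exists and is unique. *)
definition metric_proj :: "'a::real_inner set \<Rightarrow> 'a \<Rightarrow> 'a"
  where "metric_proj D x = (THE p. p \<in> D \<and> (\<forall>y\<in>D. norm (x - p) \<le> norm (x - y)))"

end

theory Submission
  imports Defs
begin

text \<open>
  Write \<open>A = I - T\<close>, \<open>F\<close> for the fixed point set and \<open>p\<close> for the projection of \<open>x 0\<close> onto \<open>F\<close>.
  Being a pseudo-contraction means that \<open>A\<close> is monotone, and for a Lipschitz self-map of \<open>C\<close> the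
  Minty trick identifies \<open>F\<close> with the solutions \<open>w \<in> C\<close> of the variational inequality
  \<open>\<langle>A y, y - w\<rangle> \<ge> 0\<close> for all \<open>y \<in> C\<close>. Each of these inequalities is a closed half-space in \<open>w\<close>, so
  \<open>F\<close> is closed and convex.

  The outer structure is Haugazeau's. The variational characterisation of the projection
  gives \<open>F \<subseteq> Q n\<close> inductively, and \<open>x n\<close> is the point of \<open>Q n\<close> nearest to \<open>x 0\<close>. Hence the numbers
  \<open>\<parallel>x n - x 0\<parallel>\<close> increase, stay below \<open>\<parallel>p - x 0\<parallel>\<close>, and the steps \<open>\<parallel>x (Suc n) - x n\<parallel>\<close> tend to \<open>0\<close>.
  As \<open>x (Suc n)\<close> lies in \<open>Cn n\<close>, short steps force \<open>\<parallel>x n - T (x n)\<parallel>\<close> to be small. Here the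
  displacement \<open>y n - x n\<close> and the gain demanded in \<open>Cn n\<close> are both proportional to \<open>\<beta> n\<close>, so
  this factor cancels and the estimate is uniform even if \<open>\<beta> n\<close> tends to \<open>0\<close>
  (\<open>relaxation_gain_le\<close>). The bounds on \<open>\<alpha>\<close> eventually keep the remaining coefficient
  \<open>\<alpha> n (1 - 2 \<alpha> n - L\<^sup>2 (\<alpha> n)\<^sup>2)\<close> away from \<open>0\<close> (\<open>relaxation_factor_bound\<close>).

  It remains to see that \<open>\<parallel>x n - x 0\<parallel>\<close> comes up to \<open>\<parallel>p - x 0\<parallel>\<close>. Usually one passes to a weak cluster
  point \<open>w\<close> of the iterates. All that is used about \<open>w\<close> is that it belongs to every closed
  convex set that contains almost all \<open>x n\<close>, and such a point is obtained directly, as a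
  common point of the closed convex hulls of the tails (\<open>ex_point_in_eventual_convex_sets\<close>).
  Applied to slightly enlarged Minty half-spaces this property gives \<open>w \<in> F\<close>
  (\<open>approximate_fixed_points_demiclosed\<close>), and applied to balls around \<open>x 0\<close> it gives
  \<open>\<parallel>w - x 0\<parallel> \<le> lim \<parallel>x n - x 0\<parallel>\<close>. Hence \<open>\<parallel>p - x 0\<parallel> \<le> lim \<parallel>x n - x 0\<parallel>\<close>, and
  \<open>\<parallel>x n - p\<parallel>\<^sup>2 \<le> \<parallel>p - x 0\<parallel>\<^sup>2 - \<parallel>x n - x 0\<parallel>\<^sup>2\<close>, a consequence of \<open>p \<in> Q n\<close>, finishes the proof.
\<close>

section \<open>Projections and intersections in Hilbert space\<close>

text \<open>
  Almost nearest points \<open>q n \<in> D n\<close> have distances to \<open>a\<close> converging to the limit of the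
  increasing distances of \<open>a\<close> to \<open>D n\<close>. Midpoints of later ones still lie in \<open>D n\<close>, so the
  parallelogram law makes \<open>q\<close> a Cauchy sequence. A constant sequence \<open>D\<close> gives the existence
  of the metric projection; decreasing ones stand in for weak compactness.
\<close>

lemma ex_near_point_in_decreasing_convex_sets:
  fixes D :: "nat \<Rightarrow> 'a::{real_inner, complete_space} set"
  assumes closed: "\<And>n. closed (D n)" and convex: "\<And>n. convex (D n)"
    and ne: "\<And>n. D n \<noteq> {}" and dec: "decseq D" and bnd: "\<And>n. infdist a (D n) \<le> r"
  obtains p where "\<And>n. p \<in> D n" and "dist a p \<le> r"
proof -
  define d where "d n = infdist a (D n)" for n
  have "incseq d"
    unfolding incseq_def d_def
    using dec ne by (auto intro!: infdist_mono simp: decseq_def)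
  moreover have "\<forall>n. d n \<le> r"
    using bnd by (simp add: d_def)
  ultimately obtain l where l: "d \<longlonglongrightarrow> l"
    by (rule incseq_convergent)
  have lr: "l \<le> r"
    using l bnd by (intro LIMSEQ_le_const2[OF l]) (auto simp: d_def)
  have "\<exists>q\<in>D n. dist a q < d n + 1 / Suc n" for n
  proof (rule ccontr)
    assume "\<not> ?thesis"
    hence "d n + 1 / Suc n \<le> infdist a (D n)"
      using ne[of n] by (auto simp: infdist_notempty not_less intro!: cINF_greatest)
    thus False by (simp add: d_def field_simps)
  qed
  then obtain q where qD: "\<And>n. q n \<in> D n" and qd: "\<And>n. dist a (q n) < d n + 1 / Suc n"
    by metis
  have dq: "d n \<le> dist a (q n)" for n
    unfolding d_def by (rule infdist_le[OF qD])
  have lim: "(\<lambda>n. dist a (q n)) \<longlonglongrightarrow> l"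
  proof (rule tendsto_sandwich[OF _ _ l])
    show "(\<lambda>n. d n + 1 / Suc n) \<longlonglongrightarrow> l"
      using tendsto_add[OF l LIMSEQ_inverse_real_of_nat] by (simp add: inverse_eq_divide)
  qed (use dq less_imp_le[OF qd] in \<open>simp_all only: eventually_True\<close>)
  have qDm: "q m \<in> D n" if "n \<le> m" for n m
    using qD[of m] dec that by (auto simp: decseq_def)
  have est: "(dist (q m) (q n))\<^sup>2 \<le> 2 * (dist a (q m))\<^sup>2 + 2 * (dist a (q n))\<^sup>2 - 4 * (d k)\<^sup>2"
    if "k \<le> m" "k \<le> n" for m n k
  proof -
    have "(1/2) *\<^sub>R q m + (1/2) *\<^sub>R q n \<in> D k"
      using convexD[OF convex qDm[OF that(1)] qDm[OF that(2)], of "1/2" "1/2"] by simp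
    hence "d k \<le> dist a ((1/2) *\<^sub>R q m + (1/2) *\<^sub>R q n)"
      unfolding d_def by (rule infdist_le)
    hence "(d k)\<^sup>2 \<le> (dist a ((1/2) *\<^sub>R q m + (1/2) *\<^sub>R q n))\<^sup>2"
      by (intro power_mono) (simp_all add: d_def infdist_nonneg)
    moreover have "(dist (q m) (q n))\<^sup>2 + 4 * (dist a ((1/2) *\<^sub>R q m + (1/2) *\<^sub>R q n))\<^sup>2
        = 2 * (dist a (q m))\<^sup>2 + 2 * (dist a (q n))\<^sup>2"
      by (simp add: dist_norm power2_norm_eq_inner inner_diff_left inner_diff_right
          inner_add_left inner_add_right inner_commute field_simps)
    ultimately show ?thesis by simp
  qed
  have "Cauchy q"
  proof (rule CauchyI')
    fix e :: real assume e: "0 < e"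
    have ev1: "\<forall>\<^sub>F n in sequentially. (dist a (q n))\<^sup>2 < l\<^sup>2 + e\<^sup>2 / 8"
      using e by (intro order_tendstoD(2)[OF tendsto_power[OF lim]]) simp
    have ev2: "\<forall>\<^sub>F n in sequentially. l\<^sup>2 - e\<^sup>2 / 8 < (d n)\<^sup>2"
      using e by (intro order_tendstoD(1)[OF tendsto_power[OF l]]) simp
    obtain M where M: "\<And>n. n \<ge> M \<Longrightarrow> (dist a (q n))\<^sup>2 < l\<^sup>2 + e\<^sup>2 / 8 \<and> l\<^sup>2 - e\<^sup>2 / 8 < (d n)\<^sup>2"
      using eventually_conj[OF ev1 ev2] unfolding eventually_sequentially by blast
    have "dist (q m) (q n) < e" if "M \<le> m" "m < n" for m n
    proof -
      have "(dist (q m) (q n))\<^sup>2 < e\<^sup>2"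
        using est[of M m n] M[of M] M[of m] M[of n] that by simp
      thus ?thesis using e by (simp add: power_less_imp_less_base)
    qed
    thus "\<exists>M. \<forall>m\<ge>M. \<forall>n>m. dist (q m) (q n) < e" by blast
  qed
  then obtain p where p: "q \<longlonglongrightarrow> p"
    using Cauchy_convergent convergent_def by blast
  show thesis
  proof
    show "p \<in> D n" for n
      using qDm by (intro Lim_in_closed_set[OF closed _ _ p])
        (auto simp: eventually_sequentially)
    have "(\<lambda>n. dist a (q n)) \<longlonglongrightarrow> dist a p"
      by (intro tendsto_intros p)
    thus "dist a p \<le> r"
      using LIMSEQ_unique[OF lim] lr by simp
  qed
qed

lemma
  fixes D :: "'a::{real_inner, complete_space} set"
  assumes "closed D" and "convex D" and "D \<noteq> {}"
  shows metric_proj_in: "metric_proj D a \<in> D"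
    and metric_proj_le: "z \<in> D \<Longrightarrow> norm (a - metric_proj D a) \<le> norm (a - z)"
proof -
  obtain p where p: "p \<in> D" "dist a p \<le> infdist a D"
    using ex_near_point_in_decreasing_convex_sets[of "\<lambda>_. D" a "infdist a D"] assms
    by (auto simp: decseq_def)
  have "metric_proj D a \<in> D \<and> (\<forall>z\<in>D. norm (a - metric_proj D a) \<le> norm (a - z))"
    unfolding metric_proj_def
  proof (rule theI)
    show *: "p \<in> D \<and> (\<forall>z\<in>D. norm (a - p) \<le> norm (a - z))"
      using p infdist_le[of _ D a] by (force simp: dist_norm)
    show "p' = p" if "p' \<in> D \<and> (\<forall>z\<in>D. norm (a - p') \<le> norm (a - z))" for p'
      using any_closest_point_unique[OF assms(2,1), of p' p a] that * by (auto simp: dist_norm)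
  qed
  thus "metric_proj D a \<in> D" and "z \<in> D \<Longrightarrow> norm (a - metric_proj D a) \<le> norm (a - z)"
    by auto
qed

lemma metric_proj_inner:
  fixes D :: "'a::{real_inner, complete_space} set"
  assumes "closed D" and "convex D" and "z \<in> D"
  shows "inner (z - metric_proj D a) (metric_proj D a - a) \<ge> 0"
proof -
  have "D \<noteq> {}" using assms(3) by blast
  hence "inner (a - metric_proj D a) (z - metric_proj D a) \<le> 0"
    using assms metric_proj_in[of D a] metric_proj_le[of D _ a]
    by (intro any_closest_point_dot[of D]) (auto simp: dist_norm)
  thus ?thesis
    by (simp add: inner_commute inner_diff_left inner_diff_right)
qed

text \<open>
  The obtuse angle condition \<open>\<langle>z - x, x - a\<rangle> \<ge> 0\<close> yields one half of Pythagoras; this is the form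
  in which membership in the sets \<open>Q n\<close> enters all metric estimates.
\<close>

lemma obtuse_angle_pythagoras:
  fixes a x z :: "'a::real_inner"
  assumes "inner (z - x) (x - a) \<ge> 0"
  shows "(norm (z - x))\<^sup>2 \<le> (norm (z - a))\<^sup>2 - (norm (x - a))\<^sup>2"
  using assms by (simp add: power2_norm_eq_inner inner_diff_left inner_diff_right inner_commute)

text \<open>
  A substitute for a weak cluster point: any common point of the closed convex hulls of the
  tails has the property. The statement is the form in which weak limits are used
  together with Mazur's theorem.
\<close>

lemma ex_point_in_eventual_convex_sets:
  fixes x :: "nat \<Rightarrow> 'a::{real_inner, complete_space}"
  assumes "bounded (range x)"
  obtains w where "\<And>K. closed K \<Longrightarrow> convex K \<Longrightarrow> \<forall>\<^sub>F n in sequentially. x n \<in> K \<Longrightarrow> w \<in> K"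
proof -
  define D where "D n = closure (convex hull (x ` {n..}))" for n
  have xD: "x n \<in> D n" for n
    unfolding D_def by (intro subsetD[OF closure_subset] hull_inc) auto
  obtain B where B: "\<And>n. norm (x n) \<le> B"
    using assms by (auto simp: bounded_iff)
  have "infdist 0 (D n) \<le> B" for n
    using infdist_le2[OF xD, of 0 n B] B by simp
  moreover have "decseq D"
    unfolding D_def decseq_def by (auto intro!: closure_mono hull_mono)
  ultimately obtain w where w: "\<And>n. w \<in> D n"
    using ex_near_point_in_decreasing_convex_sets[of D 0 B] xD
    by (metis D_def closed_closure convex_closure convex_convex_hull empty_iff)
  show thesis
  proof
    fix K :: "'a set"
    assume K: "closed K" "convex K" "\<forall>\<^sub>F n in sequentially. x n \<in> K"
    then obtain n where "x ` {n..} \<subseteq> K"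
      by (auto simp: eventually_sequentially)
    hence "D n \<subseteq> K"
      unfolding D_def using K by (intro closure_minimal hull_minimal) auto
    thus "w \<in> K" using w by blast
  qed
qed

section \<open>Fixed points of Lipschitz pseudo-contractions\<close>

lemma pseudo_contraction_on_monotone:
  assumes "pseudo_contraction_on C T" and "x \<in> C" and "y \<in> C"
  shows "inner ((x - T x) - (y - T y)) (x - y) \<ge> 0"
proof -
  have "(norm (T x - T y))\<^sup>2 \<le> (norm (x - y))\<^sup>2 + (norm ((x - T x) - (y - T y)))\<^sup>2"
    using assms by (auto simp: pseudo_contraction_on_def)
  thus ?thesis
    by (simp add: power2_norm_eq_inner inner_diff_left inner_diff_right inner_commute)
qed

text \<open>
  Minty's trick: test the inequality at \<open>y = w + s (T w - w)\<close>, which lies in \<open>C\<close>. It then reads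
  \<open>\<langle>A y, A w\<rangle> \<le> 0\<close> with \<open>A = I - T\<close>, and as \<open>\<parallel>A y - A w\<parallel> \<le> (1 + L) s \<parallel>A w\<parallel>\<close>, a small \<open>s\<close>
  leaves only \<open>A w = 0\<close>.
\<close>

lemma fixed_point_if_Minty_inequality:
  fixes T :: "'a::real_inner \<Rightarrow> 'a"
  assumes C: "convex C" and T: "T \<in> C \<rightarrow> C" and L: "L-lipschitz_on C T"
    and w: "w \<in> C" and Minty: "\<And>y. y \<in> C \<Longrightarrow> inner (y - T y) (y - w) \<ge> 0"
  shows "T w = w"
proof -
  have L0: "L \<ge> 0" using L by (rule lipschitz_on_nonneg)
  define s where "s = 1 / (2 * (1 + L))"
  have s: "0 < s" "s \<le> 1" "(1 + L) * s = 1/2"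
    using L0 by (auto simp: s_def field_simps)
  define y where "y = (1 - s) *\<^sub>R w + s *\<^sub>R T w"
  have yC: "y \<in> C"
    unfolding y_def using s w T by (intro convexD[OF C]) auto
  have yw: "y - w = - (s *\<^sub>R (w - T w))"
    by (simp add: y_def algebra_simps)
  have "s * inner (y - T y) (w - T w) \<le> 0"
    using Minty[OF yC] by (simp add: yw)
  hence "inner (y - T y) (w - T w) \<le> 0"
    using s by (simp add: mult_le_0_iff)
  hence "(norm (w - T w))\<^sup>2 \<le> inner ((w - T w) - (y - T y)) (w - T w)"
    by (simp add: power2_norm_eq_inner inner_diff_left)
  also have "\<dots> \<le> norm ((w - T w) - (y - T y)) * norm (w - T w)"
    by (rule norm_cauchy_schwarz)
  also have "\<dots> \<le> ((1 + L) * norm (y - w)) * norm (w - T w)"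
  proof (rule mult_right_mono)
    have "norm ((w - T w) - (y - T y)) = norm ((T y - T w) - (y - w))"
      by (simp add: algebra_simps)
    also have "\<dots> \<le> norm (T y - T w) + norm (y - w)"
      by (rule norm_triangle_ineq4)
    also have "\<dots> \<le> (1 + L) * norm (y - w)"
      using lipschitz_on_normD[OF L yC w] by (simp add: algebra_simps)
    finally show "norm ((w - T w) - (y - T y)) \<le> (1 + L) * norm (y - w)" .
  qed simp
  also have "\<dots> = ((1 + L) * s) * (norm (w - T w))\<^sup>2"
    using s(1) by (simp add: yw power2_eq_square)
  also have "\<dots> = (norm (w - T w))\<^sup>2 / 2"
    by (simp add: s(3))
  finally show ?thesis by simp
qed

lemma fix_set_eq_Minty:
  fixes T :: "'a::real_inner \<Rightarrow> 'a"
  assumes "convex C" and "T \<in> C \<rightarrow> C" and "L-lipschitz_on C T" and "pseudo_contraction_on C T"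
  shows "fix_set C T = C \<inter> (\<Inter>y\<in>C. {w. inner (y - T y) w \<le> inner (y - T y) y})"
proof -
  have "inner (y - T y) w \<le> inner (y - T y) y" if "w \<in> C" "T w = w" "y \<in> C" for w y
    using pseudo_contraction_on_monotone[OF assms(4) that(3,1)] that(2)
    by (simp add: inner_diff_right)
  moreover have "T w = w" if "w \<in> C" "\<And>y. y \<in> C \<Longrightarrow> inner (y - T y) w \<le> inner (y - T y) y" for w
    using that by (intro fixed_point_if_Minty_inequality[OF assms(1-3)]) (auto simp: inner_diff_right)
  ultimately show ?thesis unfolding fix_set_def by blast
qed

lemma
  fixes T :: "'a::real_inner \<Rightarrow> 'a"
  assumes "convex C" and "T \<in> C \<rightarrow> C" and "L-lipschitz_on C T" and "pseudo_contraction_on C T"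
  shows closed_fix_set: "closed C \<Longrightarrow> closed (fix_set C T)"
    and convex_fix_set: "convex (fix_set C T)"
  unfolding fix_set_eq_Minty[OF assms]
  by (intro closed_Int closed_INT ballI closed_halfspace_le | assumption)+
    (intro convex_Int convex_INT convex_halfspace_le assms)

text \<open>
  By monotonicity, \<open>x n\<close> satisfies the Minty inequality at \<open>y\<close> up to the error
  \<open>\<langle>A (x n), y - x n\<rangle>\<close> with \<open>A = I - T\<close>, which tends to \<open>0\<close>. So every slightly enlarged Minty
  half-space is a closed convex set containing almost all \<open>x n\<close>.
\<close>

lemma approximate_fixed_points_demiclosed:
  fixes T :: "'a::{real_inner, complete_space} \<Rightarrow> 'a"
  assumes "closed C" and "convex C" and T: "T \<in> C \<rightarrow> C" and L: "L-lipschitz_on C T"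
    and pc: "pseudo_contraction_on C T"
    and xC: "\<And>n. x n \<in> C" and bnd: "bounded (range x)" and lim: "(\<lambda>n. x n - T (x n)) \<longlonglongrightarrow> 0"
  obtains w where "w \<in> fix_set C T"
    and "\<And>K. closed K \<Longrightarrow> convex K \<Longrightarrow> \<forall>\<^sub>F n in sequentially. x n \<in> K \<Longrightarrow> w \<in> K"
proof -
  obtain w where w: "\<And>K. closed K \<Longrightarrow> convex K \<Longrightarrow> \<forall>\<^sub>F n in sequentially. x n \<in> K \<Longrightarrow> w \<in> K"
    using ex_point_in_eventual_convex_sets[OF bnd] by blast
  have "w \<in> C"
    using w assms by simp
  moreover have "inner (y - T y) w \<le> inner (y - T y) y" if y: "y \<in> C" for y
  proof (rule field_le_epsilon)
    fix e :: real assume e: "e > 0"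
    have "bounded ((\<lambda>z. y - z) ` range x)"
      by (rule bounded_minus_comp[of "\<lambda>_. y" _ "\<lambda>z. z"]) (use bnd in \<open>auto simp: image_constant_conv\<close>)
    hence "Bfun (\<lambda>n. y - x n) sequentially"
      by (simp add: Bseq_eq_bounded image_image)
    hence "(\<lambda>n. inner (x n - T (x n)) (y - x n)) \<longlonglongrightarrow> 0"
      using lim
      by (intro bounded_bilinear.Zfun_prod_Bfun[OF bounded_bilinear_inner, folded tendsto_Zfun_iff[where a = 0, simplified]])
    hence "\<forall>\<^sub>F n in sequentially. - e < inner (x n - T (x n)) (y - x n)"
      using e by (intro order_tendstoD(1)) auto
    hence "\<forall>\<^sub>F n in sequentially. x n \<in> {z. inner (y - T y) z \<le> inner (y - T y) y + e}"
    proof eventually_elim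
      case (elim n)
      have "inner ((y - T y) - (x n - T (x n))) (y - x n) \<ge> 0"
        using pc y xC by (rule pseudo_contraction_on_monotone)
      hence "inner (x n - T (x n)) (y - x n) \<le> inner (y - T y) (y - x n)"
        by (simp add: inner_diff_left)
      with elim show ?case by (simp add: inner_diff_right)
    qed
    hence "w \<in> {z. inner (y - T y) z \<le> inner (y - T y) y + e}"
      by (intro w closed_halfspace_le convex_halfspace_le)
    thus "inner (y - T y) w \<le> inner (y - T y) y + e" by simp
  qed
  ultimately have "w \<in> fix_set C T"
    by (simp add: fix_set_eq_Minty[OF assms(2) T L pc])
  thus thesis using w that by blast
qed

section \<open>The projection iteration\<close>

text \<open>
  Moving from \<open>x\<close> by \<open>\<beta> u\<close> lowers the squared distance to \<open>z\<close> by at most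
  \<open>2 \<beta> \<parallel>u\<parallel> \<parallel>x - z\<parallel>\<close>. If a gain of \<open>\<beta> c\<close> is achieved, the factor \<open>\<beta>\<close> cancels from the resulting
  bound.
\<close>

lemma relaxation_gain_le:
  fixes x u z :: "'a::real_inner"
  assumes "\<beta> > 0" and "(norm ((x + \<beta> *\<^sub>R u) - z))\<^sup>2 \<le> (norm (x - z))\<^sup>2 - \<beta> * c"
  shows "c \<le> 2 * norm u * norm (x - z)"
proof -
  have "(norm ((x + \<beta> *\<^sub>R u) - z))\<^sup>2 = (norm (x - z))\<^sup>2 + 2 * \<beta> * inner u (x - z) + (\<beta> * norm u)\<^sup>2"
    unfolding power_mult_distrib power2_norm_eq_inner
    by (simp add: inner_diff_left inner_diff_right inner_add_left inner_add_right
        inner_commute algebra_simps power2_eq_square)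
  hence "\<beta> * c \<le> - (2 * \<beta> * inner u (x - z))"
    using assms(2) zero_le_power2[of "\<beta> * norm u"] by linarith
  also have "\<dots> = \<beta> * (- 2 * inner u (x - z))"
    by simp
  finally have "\<beta> * c \<le> \<beta> * (- 2 * inner u (x - z))" .
  hence "c \<le> - 2 * inner u (x - z)"
    using assms(1) by (rule mult_left_le_imp_le)
  also have "\<dots> \<le> 2 * norm u * norm (x - z)"
    using Cauchy_Schwarz_ineq2[of u "x - z"] by linarith
  finally show ?thesis .
qed

text \<open>
  With \<open>r = sqrt (1 + L\<^sup>2)\<close> the quadratic factors as \<open>(1 - (1 + r) t) (1 + (r - 1) t)\<close>, and
  the bound imposed on \<open>b\<close> is its positive root. The second factor is at least \<open>1\<close>.
\<close>

lemma relaxation_factor_bound: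
  fixes L b :: real
  assumes b: "b < 1 / (sqrt (1 + L\<^sup>2) + 1)"
  shows "1 - (1 + sqrt (1 + L\<^sup>2)) * b > 0"
    and "0 \<le> t \<Longrightarrow> t \<le> b \<Longrightarrow> 1 - (1 + sqrt (1 + L\<^sup>2)) * b \<le> 1 - 2 * t - L\<^sup>2 * t\<^sup>2"
proof -
  define r where "r = sqrt (1 + L\<^sup>2)"
  have r1: "r \<ge> 1" by (simp add: r_def)
  have rr: "r * r = 1 + L\<^sup>2" by (simp add: r_def)
  show pos: "1 - (1 + sqrt (1 + L\<^sup>2)) * b > 0"
    using b r1 by (simp add: r_def[symmetric] field_simps)
  assume t: "0 \<le> t" "t \<le> b"
  have "(1 + r) * t \<le> (1 + r) * b"
    using r1 t by (intro mult_left_mono) auto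
  with pos have 1: "1 - (1 + r) * b \<le> 1 - (1 + r) * t" and 2: "0 \<le> 1 - (1 + r) * t"
    unfolding r_def by linarith+
  have 3: "1 \<le> 1 + (r - 1) * t"
    using r1 t by simp
  have "(1 - (1 + r) * b) * 1 \<le> (1 - (1 + r) * t) * (1 + (r - 1) * t)"
    by (rule mult_mono[OF 1 3 2]) simp
  also have "\<dots> = 1 - 2 * t - (r * r - 1) * t\<^sup>2"
    by (simp add: algebra_simps power2_eq_square)
  also have "\<dots> = 1 - 2 * t - L\<^sup>2 * t\<^sup>2"
    by (simp add: rr)
  finally show "1 - (1 + sqrt (1 + L\<^sup>2)) * b \<le> 1 - 2 * t - L\<^sup>2 * t\<^sup>2"
    by (simp add: r_def)
qed

theorem theorem6p1:
  fixes C :: "'a::{real_inner, complete_space} set"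
    and T :: "'a \<Rightarrow> 'a"
    and L \<alpha>_inf \<alpha>_sup :: real
    and \<alpha> \<beta> :: "nat \<Rightarrow> real"
    and x v y :: "nat \<Rightarrow> 'a"
    and Cn Cstar Q :: "nat \<Rightarrow> 'a set"
  assumes "C \<noteq> {}" and "closed C" and "convex C"
    and "T \<in> C \<rightarrow> C"
    and "L \<ge> 1" and "L-lipschitz_on C T"
    and "pseudo_contraction_on C T"
    and "fix_set C T \<noteq> {}"
    and "\<And>n. \<alpha> n \<in> {0<..<1}" and "\<And>n. \<beta> n \<in> {0<..<1}"
    and "\<And>n. 0 < \<beta> n \<and> \<beta> n \<le> \<alpha> n"
    and "liminf (\<lambda>n. ereal (\<alpha> n)) \<ge> ereal \<alpha>_inf" and "\<alpha>_inf > 0"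
    and "limsup (\<lambda>n. ereal (\<alpha> n)) \<le> ereal \<alpha>_sup"
    and "\<alpha>_sup < 1 / (sqrt (1 + L\<^sup>2) + 1)"
    and "x 0 \<in> C"
    and "\<And>n. v n = (1 - \<alpha> n) *\<^sub>R x n + \<alpha> n *\<^sub>R T (x n)"
    and "\<And>n. y n = (1 - \<beta> n) *\<^sub>R x n + \<beta> n *\<^sub>R T (v n)"
    and "\<And>n. Cn n = {z \<in> C. (norm (y n - z))\<^sup>2 \<le> (norm (x n - z))\<^sup>2
           - \<alpha> n * \<beta> n * (1 - 2 * \<alpha> n - L\<^sup>2 * (\<alpha> n)\<^sup>2) * (norm (x n - T (x n)))\<^sup>2}"
    and "\<And>n. Q n = {z \<in> C. inner (z - x n) (x n - x 0) \<ge> 0}"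
    and "\<And>n. closed (Cstar n) \<and> convex (Cstar n) \<and> fix_set C T \<subseteq> Cstar n \<and> Cstar n \<subseteq> Cn n"
    and "\<And>n. x (Suc n) = metric_proj (Cstar n \<inter> Q n) (x 0)"
  shows "x \<longlonglongrightarrow> metric_proj (fix_set C T) (x 0) \<and> metric_proj (fix_set C T) (x 0) \<in> fix_set C T"
proof -
  note clC = assms(2) and cvC = assms(3) and T = assms(4) and L1 = assms(5) and L = assms(6)
    and pc = assms(7) and neF = assms(8) and \<alpha>01 = assms(9) and \<beta>\<alpha> = assms(11)
    and v = assms(17) and y = assms(18) and Cn = assms(19) and Q = assms(20)
    and Cstar = assms(21) and xSuc = assms(22)
  define F where "F = fix_set C T"
  define p where "p = metric_proj F (x 0)"
  have FC: "F \<subseteq> C" by (auto simp: F_def fix_set_def)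
  have F: "closed F" "convex F" "F \<noteq> {}"
    using clC neF closed_fix_set[OF cvC T L pc] convex_fix_set[OF cvC T L pc] by (auto simp: F_def)
  have pF: "p \<in> F"
    unfolding p_def by (rule metric_proj_in[OF F])
  have pC: "p \<in> C" and Tp: "T p = p"
    using pF by (auto simp: F_def fix_set_def)

  have Q': "Q n = C \<inter> {z. inner (x n - x 0) z \<ge> inner (x n - x 0) (x n)}" for n
    by (auto simp: Q inner_diff_right inner_diff_left inner_commute)
  have clCQ: "closed (Cstar n \<inter> Q n)" and cvCQ: "convex (Cstar n \<inter> Q n)" for n
    unfolding Q' using Cstar[of n] clC cvC
    by (auto intro!: closed_Int convex_Int closed_halfspace_ge convex_halfspace_ge)
  have inv: "x n \<in> C \<and> F \<subseteq> Q n" for n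
  proof (induction n)
    case 0
    show ?case using assms(16) FC by (auto simp: Q)
  next
    case (Suc n)
    have FD: "F \<subseteq> Cstar n \<inter> Q n"
      using Suc Cstar[of n] by (auto simp: F_def)
    have "x (Suc n) \<in> Cstar n \<inter> Q n"
      unfolding xSuc using FD F by (intro metric_proj_in clCQ cvCQ) auto
    moreover have "inner (z - x (Suc n)) (x (Suc n) - x 0) \<ge> 0" if "z \<in> F" for z
      unfolding xSuc using FD that by (intro metric_proj_inner clCQ cvCQ) auto
    ultimately show ?case using FC by (auto simp: Q)
  qed
  have xC: "x n \<in> C" and FQ: "F \<subseteq> Q n" for n
    using inv[of n] by auto
  have xSucD: "x (Suc n) \<in> Cn n \<inter> Q n" for n
  proof -
    have "x (Suc n) \<in> Cstar n \<inter> Q n"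
      unfolding xSuc using FQ[of n] Cstar[of n] F
      by (intro metric_proj_in clCQ cvCQ) (auto simp: F_def)
    thus ?thesis using Cstar[of n] by auto
  qed

  \<comment> \<open>Twofold use of \<open>Q n\<close>: with \<open>x (Suc n)\<close> it controls the steps, with \<open>p\<close> the error.\<close>
  define h where "h n = (norm (x n - x 0))\<^sup>2" for n
  have step: "(norm (x (Suc n) - x n))\<^sup>2 \<le> h (Suc n) - h n" for n
    unfolding h_def using xSucD[of n] by (intro obtuse_angle_pythagoras) (auto simp: Q)
  have xp: "(norm (p - x n))\<^sup>2 \<le> (norm (p - x 0))\<^sup>2 - h n" for n
    unfolding h_def using FQ[of n] pF by (intro obtuse_angle_pythagoras) (auto simp: Q)
  have "h n \<le> h (Suc n)" for n
    using step[of n] zero_le_power2[of "norm (x (Suc n) - x n)"] by linarith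
  hence "incseq h" by (rule incseq_SucI)
  moreover have "\<forall>n. h n \<le> (norm (p - x 0))\<^sup>2"
    using xp zero_le_power2 by (smt (verit))
  ultimately obtain r where r: "h \<longlonglongrightarrow> r" and hr: "\<And>n. h n \<le> r"
    using incseq_convergent by blast
  have "(\<lambda>n. (norm (x (Suc n) - x n))\<^sup>2) \<longlonglongrightarrow> 0"
  proof (rule tendsto_sandwich[of "\<lambda>_. 0"])
    show "(\<lambda>n. h (Suc n) - h n) \<longlonglongrightarrow> 0"
      using tendsto_diff[OF LIMSEQ_Suc[OF r] r] by simp
  qed (use step in auto)
  hence "(\<lambda>n. sqrt ((norm (x (Suc n) - x n))\<^sup>2)) \<longlonglongrightarrow> sqrt 0"
    by (rule tendsto_real_sqrt)
  hence steps: "(\<lambda>n. norm (x n - x (Suc n))) \<longlonglongrightarrow> 0"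
    by (simp add: norm_minus_commute)

  define R where "R = norm (p - x 0)"
  have xR: "norm (x n - p) \<le> R" for n
  proof (rule power2_le_imp_le)
    show "(norm (x n - p))\<^sup>2 \<le> R\<^sup>2"
      using xp[of n] zero_le_power2[of "norm (x n - x 0)"]
      unfolding R_def h_def norm_minus_commute[of "x n" p] by linarith
  qed (simp add: R_def)
  have TR: "norm (T z - p) \<le> L * norm (z - p)" if "z \<in> C" for z
    using lipschitz_on_normD[OF L that pC] by (simp add: Tp)
  \<comment> \<open>The factor \<open>\<parallel>u\<parallel>\<close> in \<open>relaxation_gain_le\<close>, where \<open>y n = x n + \<beta> n u\<close>, has to be bounded in \<open>n\<close>.\<close>
  have uR: "norm (T (v n) - x n) \<le> (L * L + 1) * R" for n
  proof -
    have \<alpha>: "0 \<le> \<alpha> n" "\<alpha> n \<le> 1" using \<alpha>01[of n] by auto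
    have R0: "0 \<le> R" by (simp add: R_def)
    have vC: "v n \<in> C"
      unfolding v using \<alpha> xC[of n] T by (intro convexD[OF cvC]) auto
    have "norm (T (x n) - p) \<le> L * R"
      using TR[OF xC[of n]] mult_left_mono[OF xR[of n], of L] L1 by linarith
    moreover have "norm (x n - p) \<le> L * R"
      using xR[of n] mult_right_mono[OF L1 R0] by linarith
    moreover have "convex (cball p (L * R))" by simp
    ultimately have "v n \<in> cball p (L * R)"
      unfolding v using \<alpha>
      by (intro convexD) (auto simp: dist_norm norm_minus_commute)
    hence "norm (v n - p) \<le> L * R"
      by (simp add: dist_norm norm_minus_commute)
    hence "L * norm (v n - p) \<le> L * (L * R)"
      using L1 by (intro mult_left_mono) auto
    hence "norm (T (v n) - p) \<le> L * (L * R)"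
      using TR[OF vC] by linarith
    hence "norm (T (v n) - x n) \<le> L * (L * R) + R"
      using norm_triangle_ineq4[of "T (v n) - p" "x n - p"] xR[of n] by simp
    thus ?thesis by (simp add: algebra_simps)
  qed

  \<comment> \<open>Any \<open>b\<close> strictly between \<open>\<alpha>_sup\<close> and the critical value works: eventually \<open>\<alpha> n < b\<close>, and then
      \<open>k\<close> bounds \<open>\<alpha> n (1 - 2 \<alpha> n - L\<^sup>2 (\<alpha> n)\<^sup>2)\<close> from below.\<close>
  define b where "b = (\<alpha>_sup + 1 / (sqrt (1 + L\<^sup>2) + 1)) / 2"
  have b: "\<alpha>_sup < b" "b < 1 / (sqrt (1 + L\<^sup>2) + 1)"
    using assms(15) by (auto simp: b_def)
  define k where "k = \<alpha>_inf / 2 * (1 - (1 + sqrt (1 + L\<^sup>2)) * b)"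
  have k: "k > 0"
    unfolding k_def using assms(13) relaxation_factor_bound(1)[OF b(2)] by simp
  have ev1: "\<forall>\<^sub>F n in sequentially. \<alpha> n > \<alpha>_inf / 2"
  proof -
    have "ereal (\<alpha>_inf / 2) < liminf (\<lambda>n. ereal (\<alpha> n))"
      using assms(13) by (intro less_le_trans[OF _ assms(12)]) simp
    thus ?thesis using less_LiminfD by fastforce
  qed
  have ev2: "\<forall>\<^sub>F n in sequentially. \<alpha> n < b"
  proof -
    have "limsup (\<lambda>n. ereal (\<alpha> n)) < ereal b"
      using b by (intro le_less_trans[OF assms(14)]) simp
    thus ?thesis using Limsup_lessD by fastforce
  qed
  have residual: "\<forall>\<^sub>F n in sequentially. (norm (x n - T (x n)))\<^sup>2
      \<le> 2 * ((L * L + 1) * R) * norm (x n - x (Suc n)) / k"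
    using ev1 ev2
  proof eventually_elim
    case (elim n)
    let ?q = "1 - 2 * \<alpha> n - L\<^sup>2 * (\<alpha> n)\<^sup>2"
    have yn: "y n = x n + \<beta> n *\<^sub>R (T (v n) - x n)"
      by (simp add: y algebra_simps)
    have "(norm (y n - x (Suc n)))\<^sup>2
        \<le> (norm (x n - x (Suc n)))\<^sup>2 - \<beta> n * (\<alpha> n * ?q * (norm (x n - T (x n)))\<^sup>2)"
      using xSucD[of n] by (simp add: Cn mult.assoc mult.left_commute)
    hence "\<alpha> n * ?q * (norm (x n - T (x n)))\<^sup>2 \<le> 2 * norm (T (v n) - x n) * norm (x n - x (Suc n))"
      unfolding yn using \<beta>\<alpha>[of n] by (intro relaxation_gain_le) auto
    also have "\<dots> \<le> 2 * ((L * L + 1) * R) * norm (x n - x (Suc n))"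
      using uR[of n] by (intro mult_right_mono) auto
    finally have upper: "\<alpha> n * ?q * (norm (x n - T (x n)))\<^sup>2
        \<le> 2 * ((L * L + 1) * R) * norm (x n - x (Suc n))" .
    have "k \<le> \<alpha> n * ?q"
      unfolding k_def using elim \<alpha>01[of n] assms(13) relaxation_factor_bound[OF b(2)]
      by (intro mult_mono) auto
    hence "k * (norm (x n - T (x n)))\<^sup>2 \<le> \<alpha> n * ?q * (norm (x n - T (x n)))\<^sup>2"
      by (intro mult_right_mono) auto
    with upper have "k * (norm (x n - T (x n)))\<^sup>2 \<le> 2 * ((L * L + 1) * R) * norm (x n - x (Suc n))"
      by linarith
    thus ?case using k by (simp add: pos_le_divide_eq mult.commute)
  qed
  have bound_lim: "(\<lambda>n. 2 * ((L * L + 1) * R) * norm (x n - x (Suc n)) / k) \<longlonglongrightarrow> 0"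
    using tendsto_divide[OF tendsto_mult_right_zero[OF steps] tendsto_const[of k]] k by simp
  have "(\<lambda>n. (norm (x n - T (x n)))\<^sup>2) \<longlonglongrightarrow> 0"
    by (rule tendsto_sandwich[OF _ residual tendsto_const bound_lim]) simp
  hence "(\<lambda>n. sqrt ((norm (x n - T (x n)))\<^sup>2)) \<longlonglongrightarrow> sqrt 0"
    by (rule tendsto_real_sqrt)
  hence approx: "(\<lambda>n. x n - T (x n)) \<longlonglongrightarrow> 0"
    by (simp add: tendsto_norm_zero_iff)

  have "range x \<subseteq> cball p R"
    using xR by (auto simp: dist_norm norm_minus_commute)
  hence bndx: "bounded (range x)"
    using bounded_cball bounded_subset by blast
  obtain w where wF: "w \<in> F"
    and w: "\<And>K. closed K \<Longrightarrow> convex K \<Longrightarrow> \<forall>\<^sub>F n in sequentially. x n \<in> K \<Longrightarrow> w \<in> K"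
    using approximate_fixed_points_demiclosed[OF clC cvC T L pc xC bndx approx]
    unfolding F_def by blast
  \<comment> \<open>The ball around \<open>x 0\<close> that contains all \<open>x n\<close> also contains \<open>w\<close>, and \<open>p\<close> is no farther from
      \<open>x 0\<close> than \<open>w\<close>.\<close>
  have r0: "0 \<le> r" using hr[of 0] by (simp add: h_def)
  have "x n \<in> cball (x 0) (sqrt r)" for n
    using hr[of n] by (simp add: h_def dist_norm norm_minus_commute real_le_rsqrt)
  hence "w \<in> cball (x 0) (sqrt r)"
    by (intro w) auto
  hence "norm (x 0 - p) \<le> sqrt r"
    unfolding p_def using metric_proj_le[OF F wF, of "x 0"] by (simp add: dist_norm)
  hence pr: "(norm (p - x 0))\<^sup>2 \<le> r"
    using r0 by (metis norm_ge_zero norm_minus_commute power_mono real_sqrt_pow2)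

  have "(\<lambda>n. (norm (p - x n))\<^sup>2) \<longlonglongrightarrow> 0"
  proof (rule tendsto_sandwich[of "\<lambda>_. 0"])
    show "\<forall>\<^sub>F n in sequentially. (norm (p - x n))\<^sup>2 \<le> r - h n"
      using xp pr by (intro always_eventually allI) (smt (verit))
    show "(\<lambda>n. r - h n) \<longlonglongrightarrow> 0"
      using tendsto_diff[OF tendsto_const[of r] r] by simp
  qed auto
  hence "(\<lambda>n. sqrt ((norm (p - x n))\<^sup>2)) \<longlonglongrightarrow> sqrt 0"
    by (rule tendsto_real_sqrt)
  hence "x \<longlonglongrightarrow> p"
    by (simp add: tendsto_norm_zero_iff LIM_zero_iff norm_minus_commute[of p])
  thus ?thesis
    using pF by (simp add: p_def F_def)
qed

end
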